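(* Let $\alpha=(\{D_g\}_{g\in G},\{\alpha_g\}_{g\in G})$ be a partial action of a finite groupoid $G$ on a ring $R$ such that each $D_g$ is unital, and let $\beta=(\{E_g\}_{g\in G},\{\beta_g\}_{g\in G})$ be a globalization of $\alpha$ acting on a ring $T$, where $T=\bigoplus_{e\in G_0}E_e$, $R=\bigoplus_{e\in G_0}D_e$ and $D_e$ is an ideal of $E_e$ for all $e\in G_0$. Then the subrings of invariants $R^\alpha$ and $T^\beta$ are isomorphic as rings.
   Context: Rings are associative, not necessarily commutative and not necessarily unital; ideals are two-sided; the zero ring counts as unital (with identity $0$). A groupoid is a non-empty set $G$ with a partially defined associative multiplication and inverses (a small category in which every morphism is invertible). For $g\in G$ put $d(g)=g^{-1}g$ and $r(g)=gg^{-1}$; the product $gh$ exists iff $d(g)=r(h)$, and $G^2=\{(g,h): d(g)=r(h)\}$. $G_0$ is the set of identities $\{d(g):g\in G\}$. A partial action of $G$ on a ring $R$ is a pair $\alpha=(\{D_g\}_{g\in G},\{\alpha_g\}_{g\in G})$ where, for each $g\in G$, $D_{r(g)}$ is an ideal of $R$, $D_g$ is an ideal of $D_{r(g)}$, and $\alpha_g:D_{g^{-1}}\to D_g$ is a ring isomorphism, such that: (i) $\alpha_e=\mathrm{id}_{D_e}$ for all $e\in G_0$; (ii) $\alpha_h^{-1}(D_{g^{-1}}\cap D_h)\subseteq D_{(gh)^{-1}}$ for all $(g,h)\in G^2$; (iii) $\alpha_g(\alpha_h(x))=\alpha_{gh}(x)$ for all $(g,h)\in G^2$ and $x\in\alpha_h^{-1}(D_{g^{-1}}\cap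 D_h)$. It is global if, for all $(g,h)\in G^2$, $\alpha_g\alpha_h$ (taken on its largest domain $\alpha_h^{-1}(D_{g^{-1}}\cap D_h)$) equals $\alpha_{gh}$; equivalently $D_g=D_{r(g)}$ for all $g$. That $\beta$ is a globalization of $\alpha$ (the embeddings $D_e\to E_e$ being treated as inclusions of rings) means that $\beta$ is a global action of $G$ on $T$ and: $D_e$ is an ideal of $E_e$ for all $e\in G_0$; $D_g=D_{r(g)}\cap\beta_g(D_{d(g)})$ for all $g\in G$; $\beta_g(a)=\alpha_g(a)$ for all $a\in D_{g^{-1}}$; and $E_g=\sum_{r(h)=r(g)}\beta_h(D_{d(h)})$ for all $g\in G$. The direct sums are internal direct sums of ideals. Let $1_g$ denote the identity of $D_g$; $R$ is unital with $1_R=\sum_{e\in G_0}1_e$. Each $E_e$ ($e\in G_0$), being a finite sum of unital ideals, is unital, with identity denoted $1'_e$, and $T$ is unital with $1_T=\sum_{e\in G_0}1'_e$. Subrings of invariants: $R^\alpha=\{x\in R:\alpha_g(x1_{g^{-1}})=x1_g\text{ for all }g\in G\}$ and, writing $a=\sum_{e\in G_0}a_e$ with $a_e\in E_e$, $T^\beta=\{a\in T:\beta_g(a_{d(g)})=a_{r(g)}\text{ for all }g\in G\}$. *)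

theory Defs
  imports Main "HOL-Library.FuncSet"
begin

text \<open>The type class \<open>ring\<close> asks for neither commutativity nor an identity, so a ring is taken to be
  a subring \<open>S\<close> of some type of this class (possibly the whole type). The zero ring \<open>{0}\<close> is allowed
  and is unital.\<close>

definition is_subring :: "'a::ring set \<Rightarrow> bool" where
  "is_subring S \<longleftrightarrow> 0 \<in> S \<and> (\<forall>x\<in>S. \<forall>y\<in>S. x - y \<in> S \<and> x * y \<in> S)"

definition is_ideal :: "'a::ring set \<Rightarrow> 'a set \<Rightarrow> bool" where
  "is_ideal I S \<longleftrightarrow> is_subring S \<and> I \<subseteq> S \<and> 0 \<in> I \<and> (\<forall>x\<in>I. \<forall>y\<in>I. x - y \<in> I)
     \<and> (\<forall>x\<in>I. \<forall>s\<in>S. s * x \<in> I \<and> x * s \<in> I)"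

definition is_identity :: "'a::ring set \<Rightarrow> 'a \<Rightarrow> bool" where
  "is_identity S u \<longleftrightarrow> u \<in> S \<and> (\<forall>x\<in>S. u * x = x \<and> x * u = x)"

definition unital :: "'a::ring set \<Rightarrow> bool" where
  "unital S \<longleftrightarrow> (\<exists>u. is_identity S u)"

definition identity_of :: "'a::ring set \<Rightarrow> 'a" where
  "identity_of S = (THE u. is_identity S u)"

definition rng_hom_on :: "'a::ring set \<Rightarrow> 'b::ring set \<Rightarrow> ('a \<Rightarrow> 'b) \<Rightarrow> bool" where
  "rng_hom_on A B f \<longleftrightarrow> is_subring A \<and> is_subring B \<and> f \<in> A \<rightarrow> B
     \<and> (\<forall>x\<in>A. \<forall>y\<in>A. f (x + y) = f x + f y \<and> f (x * y) = f x * f y)"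

definition rng_mono_on :: "'a::ring set \<Rightarrow> 'b::ring set \<Rightarrow> ('a \<Rightarrow> 'b) \<Rightarrow> bool" where
  "rng_mono_on A B f \<longleftrightarrow> rng_hom_on A B f \<and> inj_on f A"

definition rng_iso_on :: "'a::ring set \<Rightarrow> 'b::ring set \<Rightarrow> ('a \<Rightarrow> 'b) \<Rightarrow> bool" where
  "rng_iso_on A B f \<longleftrightarrow> rng_hom_on A B f \<and> bij_betw f A B"

definition rng_isomorphic :: "'a::ring set \<Rightarrow> 'b::ring set \<Rightarrow> bool" where
  "rng_isomorphic A B \<longleftrightarrow> (\<exists>f. rng_iso_on A B f)"

text \<open>Sums and direct sums are used for finite index sets only. The summands of an element are
  collected in a function that is \<open>undefined\<close> off the index set, which makes it unique.\<close>

definition family_sum :: "'i set \<Rightarrow> ('i \<Rightarrow> 'a::ring set) \<Rightarrow> 'a set" where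
  "family_sum I A = {\<Sum>i\<in>I. f i | f. f \<in> Pi\<^sub>E I A}"

definition internal_direct_sum :: "'a::ring set \<Rightarrow> 'i set \<Rightarrow> ('i \<Rightarrow> 'a set) \<Rightarrow> bool" where
  "internal_direct_sum S I A \<longleftrightarrow> finite I \<and> is_subring S \<and> (\<forall>i\<in>I. is_ideal (A i) S)
     \<and> (\<forall>x\<in>S. \<exists>!f. f \<in> Pi\<^sub>E I A \<and> x = (\<Sum>i\<in>I. f i))"

definition summand :: "'i set \<Rightarrow> ('i \<Rightarrow> 'a::ring set) \<Rightarrow> 'a \<Rightarrow> 'i \<Rightarrow> 'a" where
  "summand I A x = (THE f. f \<in> Pi\<^sub>E I A \<and> x = (\<Sum>i\<in>I. f i))"

text \<open>The multiplication of a groupoid is a total function whose values are meaningful only on the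
  set \<open>composable\<close>, i.e. the product of \<open>g\<close> and \<open>h\<close> exists iff the source of \<open>g\<close> (written
  \<open>d(g)\<close>) is the target of \<open>h\<close> (written \<open>r(h)\<close>).\<close>

record 'g groupoid =
  elems :: "'g set"
  gmult :: "'g \<Rightarrow> 'g \<Rightarrow> 'g"
  ginv :: "'g \<Rightarrow> 'g"

definition src :: "'g groupoid \<Rightarrow> 'g \<Rightarrow> 'g" where
  "src G g = gmult G (ginv G g) g"

definition tgt :: "'g groupoid \<Rightarrow> 'g \<Rightarrow> 'g" where
  "tgt G g = gmult G g (ginv G g)"

definition composable :: "'g groupoid \<Rightarrow> ('g \<times> 'g) set" where
  "composable G = {(g, h). g \<in> elems G \<and> h \<in> elems G \<and> src G g = tgt G h}"

definition identities :: "'g groupoid \<Rightarrow> 'g set" where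
  "identities G = src G ` elems G"

definition is_groupoid :: "'g groupoid \<Rightarrow> bool" where
  "is_groupoid G \<longleftrightarrow> elems G \<noteq> {}
     \<and> (\<forall>g\<in>elems G. ginv G g \<in> elems G
          \<and> (ginv G g, g) \<in> composable G \<and> (g, ginv G g) \<in> composable G
          \<and> gmult G g (src G g) = g \<and> gmult G (tgt G g) g = g)
     \<and> (\<forall>(g, h)\<in>composable G. gmult G g h \<in> elems G
          \<and> src G (gmult G g h) = src G h \<and> tgt G (gmult G g h) = tgt G g)
     \<and> (\<forall>g h k. (g, h) \<in> composable G \<and> (h, k) \<in> composable G
          \<longrightarrow> gmult G (gmult G g h) k = gmult G g (gmult G h k))"

text \<open>The maps \<open>\<alpha> g\<close> are total functions of which only the restriction to \<open>D (ginv G g)\<close> matters;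
  \<open>comp_domain G D \<alpha> g h\<close> is the largest domain of the composite of \<open>\<alpha> g\<close> and \<open>\<alpha> h\<close>.\<close>

definition comp_domain ::
    "'g groupoid \<Rightarrow> ('g \<Rightarrow> 'a::ring set) \<Rightarrow> ('g \<Rightarrow> 'a \<Rightarrow> 'a) \<Rightarrow> 'g \<Rightarrow> 'g \<Rightarrow> 'a set" where
  "comp_domain G D \<alpha> g h = {x \<in> D (ginv G h). \<alpha> h x \<in> D (ginv G g) \<inter> D h}"

definition partial_action ::
    "'g groupoid \<Rightarrow> 'a::ring set \<Rightarrow> ('g \<Rightarrow> 'a set) \<Rightarrow> ('g \<Rightarrow> 'a \<Rightarrow> 'a) \<Rightarrow> bool" where
  "partial_action G R D \<alpha> \<longleftrightarrow> is_subring R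
     \<and> (\<forall>g\<in>elems G. is_ideal (D (tgt G g)) R \<and> is_ideal (D g) (D (tgt G g))
          \<and> rng_iso_on (D (ginv G g)) (D g) (\<alpha> g))
     \<and> (\<forall>e\<in>identities G. \<forall>x\<in>D e. \<alpha> e x = x)
     \<and> (\<forall>(g, h)\<in>composable G. comp_domain G D \<alpha> g h \<subseteq> D (ginv G (gmult G g h)))
     \<and> (\<forall>(g, h)\<in>composable G. \<forall>x\<in>comp_domain G D \<alpha> g h. \<alpha> g (\<alpha> h x) = \<alpha> (gmult G g h) x)"

definition global_action ::
    "'g groupoid \<Rightarrow> 'a::ring set \<Rightarrow> ('g \<Rightarrow> 'a set) \<Rightarrow> ('g \<Rightarrow> 'a \<Rightarrow> 'a) \<Rightarrow> bool" where
  "global_action G T E \<beta> \<longleftrightarrow> partial_action G T E \<beta>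
     \<and> (\<forall>(g, h)\<in>composable G. comp_domain G E \<beta> g h = E (ginv G (gmult G g h))
          \<and> (\<forall>x\<in>E (ginv G (gmult G g h)). \<beta> g (\<beta> h x) = \<beta> (gmult G g h) x))"

text \<open>\<open>\<psi> e\<close> is the embedding of \<open>D e\<close> into \<open>E e\<close>. It is usually suppressed from the notation;
  with \<open>\<psi> e\<close> the identity, the conditions become those for inclusions of rings.\<close>

definition globalization ::
    "'g groupoid \<Rightarrow> ('g \<Rightarrow> 'r::ring set) \<Rightarrow> ('g \<Rightarrow> 'r \<Rightarrow> 'r)
     \<Rightarrow> 't::ring set \<Rightarrow> ('g \<Rightarrow> 't set) \<Rightarrow> ('g \<Rightarrow> 't \<Rightarrow> 't) \<Rightarrow> ('g \<Rightarrow> 'r \<Rightarrow> 't) \<Rightarrow> bool" where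
  "globalization G D \<alpha> T E \<beta> \<psi> \<longleftrightarrow> global_action G T E \<beta>
     \<and> (\<forall>e\<in>identities G. rng_mono_on (D e) (E e) (\<psi> e) \<and> is_ideal (\<psi> e ` D e) (E e))
     \<and> (\<forall>g\<in>elems G.
          \<psi> (tgt G g) ` D g = \<psi> (tgt G g) ` D (tgt G g) \<inter> \<beta> g ` \<psi> (src G g) ` D (src G g)
          \<and> (\<forall>a\<in>D (ginv G g). \<beta> g (\<psi> (src G g) a) = \<psi> (tgt G g) (\<alpha> g a))
          \<and> E g = family_sum {h \<in> elems G. tgt G h = tgt G g}
                    (\<lambda>h. \<beta> h ` \<psi> (src G h) ` D (src G h)))"

definition partial_invariants ::
    "'g groupoid \<Rightarrow> 'a::ring set \<Rightarrow> ('g \<Rightarrow> 'a set) \<Rightarrow> ('g \<Rightarrow> 'a \<Rightarrow> 'a) \<Rightarrow> 'a set" where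
  "partial_invariants G R D \<alpha> =
     {x \<in> R. \<forall>g\<in>elems G. \<alpha> g (x * identity_of (D (ginv G g))) = x * identity_of (D g)}"

definition global_invariants ::
    "'g groupoid \<Rightarrow> 'a::ring set \<Rightarrow> ('g \<Rightarrow> 'a set) \<Rightarrow> ('g \<Rightarrow> 'a \<Rightarrow> 'a) \<Rightarrow> 'a set" where
  "global_invariants G T E \<beta> =
     {a \<in> T. \<forall>g\<in>elems G.
        \<beta> g (summand (identities G) E a (src G g)) = summand (identities G) E a (tgt G g)}"

end

theory Submission
  imports Defs
begin

text \<open>For an identity \<open>e\<close> let \<open>p e\<close> be the image of the unit of \<open>D e\<close> in \<open>E e\<close>. As the unit of an ideal
  it is a central idempotent of \<open>E e\<close>. The isomorphism from the global to the partial invariants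
  truncates: it sends \<open>a\<close> to the element of \<open>R\<close> whose component at \<open>e\<close> corresponds to
  \<open>a\<^sub>e * p e\<close>, which is multiplication by the unit of \<open>R\<close> when \<open>R\<close> lies in \<open>T\<close>.

  Write \<open>u h\<close> for the translate of \<open>p (src h)\<close> by \<open>\<beta> h\<close>. The ring \<open>E e\<close> is the sum of the ideals generated
  by the central idempotents \<open>u h\<close> with target \<open>e\<close>, so these idempotents behave like a finite cover
  of \<open>E e\<close>: an element is determined by its products with all \<open>u h\<close>
  (\<open>eq_if_eq_on_idempotents\<close>), and a family of local data that agrees on overlaps comes from
  an element (\<open>glue_along_idempotents\<close>). An invariant \<open>a\<close> satisfies
  \<open>a\<^sub>e * u h = \<beta> h (a\<^sub>d * p d)\<close> for \<open>d = src h\<close>, so its truncation prescribes its products with the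
  cover: truncation is injective. Conversely, a partial invariant \<open>x\<close> prescribes the local
  data \<open>\<beta> h (\<psi> d x\<^sub>d)\<close>. They agree on overlaps: after translation by the inverse of one of the two groupoid
  elements involved, this becomes the invariance of \<open>x\<close>, because
  \<open>u g * p (tgt g)\<close> is the image of the unit of \<open>D g\<close> (\<open>translated_unit_times_unit\<close>).
  Translating a glued element gives a solution of the same gluing problem at another
  identity, so uniqueness makes the glued elements invariant, and truncation is surjective.\<close>

section \<open>Rings, ideals and units\<close>

lemma subring_closed:
  assumes "is_subring S"
  shows subring_zero: "0 \<in> S"
    and subring_diff: "\<And>x y. x \<in> S \<Longrightarrow> y \<in> S \<Longrightarrow> x - y \<in> S"
    and subring_mult: "\<And>x y. x \<in> S \<Longrightarrow> y \<in> S \<Longrightarrow> x * y \<in> S"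
    and subring_add: "\<And>x y. x \<in> S \<Longrightarrow> y \<in> S \<Longrightarrow> x + y \<in> S"
proof -
  show z: "0 \<in> S" and d: "\<And>x y. x \<in> S \<Longrightarrow> y \<in> S \<Longrightarrow> x - y \<in> S"
    and "\<And>x y. x \<in> S \<Longrightarrow> y \<in> S \<Longrightarrow> x * y \<in> S"
    using assms unfolding is_subring_def by auto
  fix x y assume "x \<in> S" "y \<in> S"
  then have "x - (0 - y) \<in> S" using z d by blast
  then show "x + y \<in> S" by simp
qed

lemma subring_sum:
  assumes "is_subring S" "\<And>i. i \<in> I \<Longrightarrow> f i \<in> S"
  shows "sum f I \<in> S"
  using assms(2)
  by (induction I rule: infinite_finite_induct)
    (auto intro: subring_zero[OF assms(1)] subring_add[OF assms(1)])

lemma ideal_subset: "is_ideal I S \<Longrightarrow> x \<in> I \<Longrightarrow> x \<in> S"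
  unfolding is_ideal_def by auto

lemma ideal_mult_left: "is_ideal I S \<Longrightarrow> x \<in> I \<Longrightarrow> s \<in> S \<Longrightarrow> s * x \<in> I"
  unfolding is_ideal_def by auto

lemma ideal_mult_right: "is_ideal I S \<Longrightarrow> x \<in> I \<Longrightarrow> s \<in> S \<Longrightarrow> x * s \<in> I"
  unfolding is_ideal_def by auto

lemma ideal_imp_subring: "is_ideal I S \<Longrightarrow> is_subring I"
  unfolding is_ideal_def is_subring_def by blast

lemma is_identity_identity_of:
  assumes "unital S"
  shows "is_identity S (identity_of S)"
proof -
  obtain u where u: "is_identity S u" using assms unfolding unital_def by blast
  have "v = u" if "is_identity S v" for v
    using u that unfolding is_identity_def by metis
  then show ?thesis unfolding identity_of_def using u by (rule theI[rotated])
qed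

text \<open>For \<open>s\<close> in the ambient ring both \<open>s * u\<close> and \<open>u * s\<close> lie in the ideal, and therefore both equal
  \<open>u * s * u\<close>.\<close>

lemma ideal_identity_central:
  assumes "is_ideal I S" "is_identity I u" "s \<in> S"
  shows "s * u = u * s"
proof -
  have "u \<in> I" using assms(2) unfolding is_identity_def by blast
  then have "s * u \<in> I" "u * s \<in> I"
    using assms ideal_mult_left ideal_mult_right by blast+
  then have "u * (s * u) = s * u" "(u * s) * u = u * s"
    using assms(2) unfolding is_identity_def by blast+
  then show ?thesis by (simp add: mult.assoc)
qed

lemma rng_hom_on_closed:
  assumes "rng_hom_on A B f"
  shows hom_mem: "\<And>x. x \<in> A \<Longrightarrow> f x \<in> B"
    and hom_add: "\<And>x y. x \<in> A \<Longrightarrow> y \<in> A \<Longrightarrow> f (x + y) = f x + f y"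
    and hom_mult: "\<And>x y. x \<in> A \<Longrightarrow> y \<in> A \<Longrightarrow> f (x * y) = f x * f y"
    and hom_diff: "\<And>x y. x \<in> A \<Longrightarrow> y \<in> A \<Longrightarrow> f (x - y) = f x - f y"
    and hom_zero: "f 0 = 0"
proof -
  have A: "is_subring A" and
    m: "\<And>x. x \<in> A \<Longrightarrow> f x \<in> B" and
    a: "\<And>x y. x \<in> A \<Longrightarrow> y \<in> A \<Longrightarrow> f (x + y) = f x + f y" and
    t: "\<And>x y. x \<in> A \<Longrightarrow> y \<in> A \<Longrightarrow> f (x * y) = f x * f y"
    using assms unfolding rng_hom_on_def by auto
  show "\<And>x. x \<in> A \<Longrightarrow> f x \<in> B" by (fact m)
  show "\<And>x y. x \<in> A \<Longrightarrow> y \<in> A \<Longrightarrow> f (x + y) = f x + f y" by (fact a)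
  show "\<And>x y. x \<in> A \<Longrightarrow> y \<in> A \<Longrightarrow> f (x * y) = f x * f y" by (fact t)
  show "f (x - y) = f x - f y" if "x \<in> A" "y \<in> A" for x y
    using a[OF subring_diff[OF A that] that(2)] by simp
  show "f 0 = 0" using a[OF subring_zero[OF A] subring_zero[OF A]] by simp
qed

lemma identity_image:
  assumes "rng_hom_on A B f" "is_identity A u"
  shows "is_identity (f ` A) (f u)"
proof -
  have u: "u \<in> A" "\<And>x. x \<in> A \<Longrightarrow> u * x = x \<and> x * u = x"
    using assms(2) unfolding is_identity_def by blast+
  have "f u * f x = f x \<and> f x * f u = f x" if "x \<in> A" for x
    using hom_mult[OF assms(1) u(1) that] hom_mult[OF assms(1) that u(1)] u(2)[OF that] by simp
  then show ?thesis using u(1) unfolding is_identity_def by blast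
qed

lemma rng_iso_on_inv_into:
  assumes "rng_iso_on A B f"
  shows "rng_iso_on B A (inv_into A f)"
proof -
  have hom: "rng_hom_on A B f" and bij: "bij_betw f A B"
    using assms unfolding rng_iso_on_def by blast+
  have A: "is_subring A" and B: "is_subring B" using hom unfolding rng_hom_on_def by blast+
  let ?g = "inv_into A f"
  have gA: "?g y \<in> A" and fg: "f (?g y) = y" if "y \<in> B" for y
    using that bij by (auto simp: bij_betw_def inv_into_into f_inv_into_f)
  have gI: "?g y = x" if "x \<in> A" "f x = y" for x y
    using that bij by (auto simp: bij_betw_def inv_into_f_f)
  have "?g (x + y) = ?g x + ?g y \<and> ?g (x * y) = ?g x * ?g y" if "x \<in> B" "y \<in> B" for x y
    using that gA fg hom_add[OF hom] hom_mult[OF hom] subring_add[OF A] subring_mult[OF A]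
    by (intro conjI gI) simp_all
  then have "rng_hom_on B A ?g" unfolding rng_hom_on_def using A B gA by blast
  then show ?thesis unfolding rng_iso_on_def using bij_betw_inv_into[OF bij] by blast
qed

section \<open>Covers by central idempotents\<close>

text \<open>The local data are added one index at a time. If \<open>z\<close> solves the problem for the indices seen so
  far and \<open>k\<close> is new, then \<open>z + (y k - z * u k)\<close> is right at \<open>k\<close>, and the correction vanishes on
  the earlier \<open>u i\<close> because \<open>y k\<close> and \<open>z\<close> agree on \<open>u k * u i\<close>.\<close>

lemma glue_along_idempotents:
  fixes u y :: "'i \<Rightarrow> 'a::ring"
  assumes "finite I" "is_subring S"
    and "\<And>i. i \<in> I \<Longrightarrow> u i \<in> S" "\<And>i. i \<in> I \<Longrightarrow> y i \<in> S"
    and "\<And>i s. i \<in> I \<Longrightarrow> s \<in> S \<Longrightarrow> s * u i = u i * s"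
    and "\<And>i. i \<in> I \<Longrightarrow> u i * u i = u i"
    and "\<And>i. i \<in> I \<Longrightarrow> y i * u i = y i"
    and "\<And>i j. i \<in> I \<Longrightarrow> j \<in> I \<Longrightarrow> y i * u j = y j * u i"
  shows "\<exists>z\<in>S. \<forall>i\<in>I. z * u i = y i"
  using assms(1,3-)
proof (induction I rule: finite_induct)
  case empty
  then show ?case using subring_zero[OF assms(2)] by blast
next
  case (insert k I)
  have "\<exists>z\<in>S. \<forall>i\<in>I. z * u i = y i"
    by (rule insert.IH; rule insert.prems; simp)
  then obtain z where z: "z \<in> S" "\<And>i. i \<in> I \<Longrightarrow> z * u i = y i" by blast
  let ?z = "z + (y k - z * u k)"
  have "?z \<in> S"
    using z(1) insert.prems(1,2)
    by (intro subring_add[OF assms(2)] subring_diff[OF assms(2)] subring_mult[OF assms(2)]) simp_all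
  moreover have "?z * u k = y k"
    using insert.prems(4,5)[of k] by (simp add: algebra_simps)
  moreover have "?z * u i = y i" if "i \<in> I" for i
  proof -
    have "z * u k * u i = z * u i * u k"
      using insert.prems(3)[of i "u k"] insert.prems(1)[of k] that by (simp add: mult.assoc)
    also have "\<dots> = y k * u i"
      using z(2)[OF that] insert.prems(6)[of i k] that by simp
    finally show ?thesis using z(2)[OF that] by (simp add: algebra_simps)
  qed
  ultimately show ?case by blast
qed

text \<open>Gluing the \<open>u i\<close> themselves gives a unit \<open>w\<close> of \<open>S\<close>. A difference that is annihilated by all
  \<open>u i\<close> is annihilated by \<open>S\<close>, hence by \<open>w\<close>.\<close>

lemma eq_if_eq_on_idempotents:
  fixes u :: "'i \<Rightarrow> 'a::ring"
  assumes "finite I" and S: "is_subring S"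
    and u: "\<And>i. i \<in> I \<Longrightarrow> u i \<in> S"
    and central: "\<And>i s. i \<in> I \<Longrightarrow> s \<in> S \<Longrightarrow> s * u i = u i * s"
    and idem: "\<And>i. i \<in> I \<Longrightarrow> u i * u i = u i"
    and cover: "\<And>s. s \<in> S \<Longrightarrow> \<exists>f. (\<forall>i\<in>I. f i \<in> S \<and> f i * u i = f i) \<and> s = (\<Sum>i\<in>I. f i)"
    and "x \<in> S" "y \<in> S" and eq: "\<And>i. i \<in> I \<Longrightarrow> x * u i = y * u i"
  shows "x = y"
proof -
  have "\<exists>w\<in>S. \<forall>i\<in>I. w * u i = u i"
  proof (rule glue_along_idempotents[OF assms(1) S u u central idem idem])
    show "u i * u j = u j * u i" if "i \<in> I" "j \<in> I" for i j
      using central[OF that(2) u[OF that(1)]] .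
  qed
  then obtain w where w: "w \<in> S" "\<And>i. i \<in> I \<Longrightarrow> w * u i = u i" by blast
  let ?z = "x - y"
  have z: "?z \<in> S" using assms subring_diff by blast
  have "?z * w = ?z"
  proof -
    obtain f where f: "\<And>i. i \<in> I \<Longrightarrow> f i \<in> S \<and> f i * u i = f i" "?z = (\<Sum>i\<in>I. f i)"
      using cover[OF z] by blast
    have "f i * w = f i" if "i \<in> I" for i
    proof -
      have "f i * w = f i * u i * w" using f(1)[OF that] by simp
      also have "\<dots> = f i * (w * u i)" using central[OF that w(1)] by (simp add: mult.assoc)
      finally show ?thesis using w(2)[OF that] f(1)[OF that] by simp
    qed
    then show ?thesis unfolding f(2) by (simp add: sum_distrib_right)
  qed
  moreover have "?z * w = 0"
  proof -
    obtain f where f: "\<And>i. i \<in> I \<Longrightarrow> f i \<in> S \<and> f i * u i = f i" "w = (\<Sum>i\<in>I. f i)"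
      using cover[OF w(1)] by blast
    have "?z * f i = 0" if "i \<in> I" for i
    proof -
      have "u i * f i = f i" using f(1)[OF that] central[OF that] by metis
      then have "?z * f i = ?z * u i * f i" by (simp add: mult.assoc)
      then show ?thesis using eq[OF that] by (simp add: left_diff_distrib)
    qed
    then show ?thesis unfolding f(2) by (simp add: sum_distrib_left)
  qed
  ultimately show ?thesis by simp
qed

section \<open>Components in an internal direct sum of ideals\<close>

locale direct_sum_of_ideals =
  fixes S :: "'a::ring set" and I :: "'i set" and A :: "'i \<Rightarrow> 'a set"
  assumes direct_sum: "internal_direct_sum S I A"
begin

abbreviation comp :: "'a \<Rightarrow> 'i \<Rightarrow> 'a" where
  "comp \<equiv> summand I A"

lemma finite_index: "finite I"
  using direct_sum unfolding internal_direct_sum_def by blast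

lemma ideal: "i \<in> I \<Longrightarrow> is_ideal (A i) S"
  using direct_sum unfolding internal_direct_sum_def by blast

lemma subring: "is_subring S"
  using direct_sum unfolding internal_direct_sum_def by blast

lemma subring_summand: "i \<in> I \<Longrightarrow> is_subring (A i)"
  using ideal ideal_imp_subring by blast

lemma comp_spec:
  assumes "x \<in> S"
  shows "comp x \<in> Pi\<^sub>E I A" "(\<Sum>i\<in>I. comp x i) = x"
proof -
  have "\<exists>!f. f \<in> Pi\<^sub>E I A \<and> x = (\<Sum>i\<in>I. f i)"
    using direct_sum assms unfolding internal_direct_sum_def by blast
  from theI'[OF this] show "comp x \<in> Pi\<^sub>E I A" "(\<Sum>i\<in>I. comp x i) = x"
    unfolding summand_def by simp_all
qed

lemma comp_mem: "x \<in> S \<Longrightarrow> i \<in> I \<Longrightarrow> comp x i \<in> A i"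
  using comp_spec(1) by (auto simp: PiE_iff)

lemma sum_mem:
  assumes "\<And>i. i \<in> I \<Longrightarrow> f i \<in> A i"
  shows "(\<Sum>i\<in>I. f i) \<in> S"
  using assms ideal ideal_subset by (intro subring_sum[OF subring]) blast

lemma comp_sum:
  assumes "\<And>i. i \<in> I \<Longrightarrow> f i \<in> A i" and "i \<in> I"
  shows "comp (\<Sum>i\<in>I. f i) i = f i"
proof -
  let ?x = "\<Sum>i\<in>I. f i"
  have x: "?x \<in> S" using assms(1) by (rule sum_mem)
  then have "\<exists>!f. f \<in> Pi\<^sub>E I A \<and> ?x = (\<Sum>i\<in>I. f i)"
    using direct_sum unfolding internal_direct_sum_def by blast
  moreover have "restrict f I \<in> Pi\<^sub>E I A \<and> ?x = (\<Sum>i\<in>I. restrict f I i)"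
    using assms(1) by auto
  moreover have "comp ?x \<in> Pi\<^sub>E I A \<and> ?x = (\<Sum>i\<in>I. comp ?x i)" using comp_spec[OF x] by simp
  ultimately have "comp ?x = restrict f I" by blast
  then show ?thesis using assms(2) by simp
qed

lemma comp_eqI:
  assumes "x \<in> S" "y \<in> S" "\<And>i. i \<in> I \<Longrightarrow> comp x i = comp y i"
  shows "x = y"
proof -
  have "x = (\<Sum>i\<in>I. comp x i)" using comp_spec(2)[OF assms(1)] by (rule sym)
  also have "\<dots> = (\<Sum>i\<in>I. comp y i)" using assms(3) by (rule sum.cong[OF refl])
  also have "\<dots> = y" using comp_spec(2)[OF assms(2)] .
  finally show ?thesis .
qed

lemma comp_add:
  assumes "x \<in> S" "y \<in> S" "i \<in> I"
  shows "comp (x + y) i = comp x i + comp y i"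
proof -
  have "x + y = (\<Sum>i\<in>I. comp x i + comp y i)"
    unfolding sum.distrib comp_spec(2)[OF assms(1)] comp_spec(2)[OF assms(2)] ..
  moreover have "comp (\<Sum>i\<in>I. comp x i + comp y i) i = comp x i + comp y i"
    by (rule comp_sum[OF subring_add[OF subring_summand comp_mem[OF assms(1)] comp_mem[OF assms(2)]]])
      (use assms(3) in simp_all)
  ultimately show ?thesis by simp
qed

lemma comp_diff:
  assumes "x \<in> S" "y \<in> S" "i \<in> I"
  shows "comp (x - y) i = comp x i - comp y i"
  using comp_add[OF subring_diff[OF subring assms(1,2)] assms(2,3)] by simp

lemma comp_zero: "i \<in> I \<Longrightarrow> comp 0 i = 0"
  using comp_diff[OF subring_zero[OF subring] subring_zero[OF subring]] by simp

text \<open>The product lies in both ideals. It has an expansion supported at \<open>i\<close> and another supported at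
  \<open>j\<close>, so uniqueness of components makes it zero.\<close>

lemma mult_distinct_summands:
  assumes "i \<in> I" "j \<in> I" "i \<noteq> j" "x \<in> A i" "y \<in> A j"
  shows "x * y = 0"
proof -
  let ?z = "x * y"
  have z: "?z \<in> A i" "?z \<in> A j"
    using ideal_mult_right[OF ideal[OF assms(1)] assms(4) ideal_subset[OF ideal[OF assms(2)] assms(5)]]
      ideal_mult_left[OF ideal[OF assms(2)] assms(5) ideal_subset[OF ideal[OF assms(1)] assms(4)]] .
  have single: "comp ?z i = (if k = i then ?z else 0)" if k: "k \<in> I" "?z \<in> A k" for k
  proof -
    have "comp (\<Sum>l\<in>I. if l = k then ?z else 0) i = (if i = k then ?z else 0)"
      using k assms(1) subring_zero[OF subring_summand]
      by (intro comp_sum[where f = "\<lambda>l. if l = k then ?z else 0"]) simp_all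
    then show ?thesis using k(1) finite_index by simp
  qed
  from single[OF assms(1) z(1)] single[OF assms(2) z(2)] assms(3) show ?thesis by simp
qed

lemma mult_summand:
  assumes "x \<in> S" "i \<in> I" "y \<in> A i"
  shows "x * y = comp x i * y"
proof -
  have "x * y = (\<Sum>k\<in>I. comp x k * y)"
    unfolding sum_distrib_right[symmetric] comp_spec(2)[OF assms(1)] ..
  also have "\<dots> = (\<Sum>k\<in>I. if k = i then comp x i * y else 0)"
    using mult_distinct_summands[OF _ assms(2) _ comp_mem[OF assms(1)] assms(3)]
    by (intro sum.cong) auto
  finally show ?thesis using assms(2) finite_index by simp
qed

lemma comp_mult:
  assumes "x \<in> S" "y \<in> S" "i \<in> I"
  shows "comp (x * y) i = comp x i * comp y i"
proof -
  have "x * y = (\<Sum>k\<in>I. x * comp y k)"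
    unfolding sum_distrib_left[symmetric] comp_spec(2)[OF assms(2)] ..
  also have "\<dots> = (\<Sum>k\<in>I. comp x k * comp y k)"
    using mult_summand[OF assms(1)] comp_mem[OF assms(2)] by (intro sum.cong) auto
  finally have "x * y = (\<Sum>k\<in>I. comp x k * comp y k)" .
  moreover have "comp (\<Sum>k\<in>I. comp x k * comp y k) i = comp x i * comp y i"
    by (rule comp_sum[OF subring_mult[OF subring_summand comp_mem[OF assms(1)] comp_mem[OF assms(2)]]])
      (use assms(3) in simp_all)
  ultimately show ?thesis by simp
qed

end

section \<open>Groupoids\<close>

locale groupoid_laws =
  fixes G :: "'g groupoid"
  assumes groupoid: "is_groupoid G"
begin

lemma inv_mem: "g \<in> elems G \<Longrightarrow> ginv G g \<in> elems G"
  using groupoid unfolding is_groupoid_def by blast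

lemma src_inv: "g \<in> elems G \<Longrightarrow> src G (ginv G g) = tgt G g"
  using groupoid unfolding is_groupoid_def composable_def by blast

lemma tgt_inv: "g \<in> elems G \<Longrightarrow> tgt G (ginv G g) = src G g"
  using groupoid unfolding is_groupoid_def composable_def by force

lemma composableI:
  "g \<in> elems G \<Longrightarrow> h \<in> elems G \<Longrightarrow> src G g = tgt G h \<Longrightarrow> (g, h) \<in> composable G"
  unfolding composable_def by blast

lemma mult_closed:
  assumes "g \<in> elems G" "h \<in> elems G" "src G g = tgt G h"
  shows mult_mem: "gmult G g h \<in> elems G"
    and src_mult: "src G (gmult G g h) = src G h"
    and tgt_mult: "tgt G (gmult G g h) = tgt G g"
  using groupoid composableI[OF assms] unfolding is_groupoid_def by blast+

lemma assoc:
  assumes "g \<in> elems G" "h \<in> elems G" "k \<in> elems G" "src G g = tgt G h" "src G h = tgt G k"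
  shows "gmult G (gmult G g h) k = gmult G g (gmult G h k)"
  using groupoid composableI assms unfolding is_groupoid_def by blast

lemma tgt_mult_self: "g \<in> elems G \<Longrightarrow> gmult G (tgt G g) g = g"
  using groupoid unfolding is_groupoid_def by blast

lemma src_identity: "g \<in> elems G \<Longrightarrow> src G g \<in> identities G"
  unfolding identities_def by blast

lemma tgt_identity: "g \<in> elems G \<Longrightarrow> tgt G g \<in> identities G"
  using src_identity[OF inv_mem] src_inv by simp

lemma identity_laws:
  assumes "e \<in> identities G"
  shows identity_mem: "e \<in> elems G" and src_of_identity: "src G e = e" and tgt_of_identity: "tgt G e = e"
proof -
  obtain g where g: "g \<in> elems G" "e = src G g" using assms unfolding identities_def by blast
  have e: "e = gmult G (ginv G g) g" using g(2) unfolding src_def .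
  from mult_closed[OF inv_mem[OF g(1)] g(1) src_inv[OF g(1)]]
  show "e \<in> elems G" "src G e = e" "tgt G e = e"
    using g tgt_inv[OF g(1)] unfolding e[symmetric] by auto
qed

lemma inv_inv:
  assumes "g \<in> elems G"
  shows "ginv G (ginv G g) = g"
proof -
  let ?h = "ginv G g" and ?k = "ginv G (ginv G g)"
  have h: "?h \<in> elems G" and k: "?k \<in> elems G" using inv_mem assms by blast+
  have "src G ?k = src G g" using src_inv[OF h] tgt_inv[OF assms] by simp
  moreover have "gmult G ?k (src G ?k) = ?k"
    using k groupoid unfolding is_groupoid_def by blast
  ultimately have "?k = gmult G ?k (gmult G ?h g)" unfolding src_def by simp
  also have "\<dots> = gmult G (gmult G ?k ?h) g"
    using assoc[OF k h assms src_inv[OF h] src_inv[OF assms]] by simp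
  also have "gmult G ?k ?h = tgt G g" using src_inv[OF assms] unfolding src_def .
  finally show ?thesis using tgt_mult_self[OF assms] by simp
qed

lemma left_division:
  assumes g: "g \<in> elems G" and h: "h \<in> elems G" and gh: "tgt G g = tgt G h"
  obtains k where "k \<in> elems G" "src G k = src G h" "tgt G k = src G g" "gmult G g k = h"
proof (rule that)
  let ?k = "gmult G (ginv G g) h"
  have g': "ginv G g \<in> elems G" "src G (ginv G g) = tgt G h" using inv_mem src_inv g gh by simp_all
  show "?k \<in> elems G" "src G ?k = src G h" "tgt G ?k = src G g"
    using mult_closed[OF g'(1) h g'(2)] tgt_inv[OF g] by auto
  have "gmult G g ?k = gmult G (gmult G g (ginv G g)) h"
    using assoc[OF g g'(1) h tgt_inv[OF g, symmetric] g'(2)] by simp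
  also have "gmult G g (ginv G g) = tgt G h" using gh unfolding tgt_def by simp
  finally show "gmult G g ?k = h" using tgt_mult_self[OF h] by simp
qed

end

section \<open>Partial actions with a globalization\<close>

locale globalized_action = groupoid_laws G
  for G :: "'g groupoid" +
  fixes R :: "'r::ring set" and D :: "'g \<Rightarrow> 'r set" and \<alpha> :: "'g \<Rightarrow> 'r \<Rightarrow> 'r"
    and T :: "'t::ring set" and E :: "'g \<Rightarrow> 't set" and \<beta> :: "'g \<Rightarrow> 't \<Rightarrow> 't"
    and \<psi> :: "'g \<Rightarrow> 'r \<Rightarrow> 't"
  assumes finite_elems: "finite (elems G)"
    and partial: "partial_action G R D \<alpha>"
    and unital_D: "\<forall>g\<in>elems G. unital (D g)"
    and globalization: "globalization G D \<alpha> T E \<beta> \<psi>"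
    and direct_sum_E: "internal_direct_sum T (identities G) E"
    and direct_sum_D: "internal_direct_sum R (identities G) D"
begin

sublocale R: direct_sum_of_ideals R "identities G" D
  by unfold_locales (fact direct_sum_D)

sublocale T: direct_sum_of_ideals T "identities G" E
  by unfold_locales (fact direct_sum_E)

abbreviation one :: "'g \<Rightarrow> 'r" where
  "one g \<equiv> identity_of (D g)"

definition p :: "'g \<Rightarrow> 't" where
  "p e = \<psi> e (one e)"

definition u :: "'g \<Rightarrow> 't" where
  "u g = \<beta> g (p (src G g))"

subsection \<open>The partial action\<close>

lemma ideal_D: "g \<in> elems G \<Longrightarrow> is_ideal (D g) (D (tgt G g))"
  using partial unfolding partial_action_def by blast

lemma ideal_D_inv: "g \<in> elems G \<Longrightarrow> is_ideal (D (ginv G g)) (D (src G g))"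
  using ideal_D[OF inv_mem] tgt_inv by simp

lemma hom_\<alpha>: "g \<in> elems G \<Longrightarrow> rng_hom_on (D (ginv G g)) (D g) (\<alpha> g)"
  using partial unfolding partial_action_def rng_iso_on_def by blast

lemma bij_\<alpha>: "g \<in> elems G \<Longrightarrow> bij_betw (\<alpha> g) (D (ginv G g)) (D g)"
  using partial unfolding partial_action_def rng_iso_on_def by blast

lemma one: "g \<in> elems G \<Longrightarrow> is_identity (D g) (one g)"
  using unital_D is_identity_identity_of by blast

lemma one_mem: "g \<in> elems G \<Longrightarrow> one g \<in> D g"
  using one unfolding is_identity_def by blast

lemma \<alpha>_one:
  assumes "g \<in> elems G"
  shows "\<alpha> g (one (ginv G g)) = one g"
proof -
  have "is_identity (D g) (\<alpha> g (one (ginv G g)))"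
    using identity_image[OF hom_\<alpha>[OF assms] one[OF inv_mem[OF assms]]] bij_\<alpha>[OF assms]
    unfolding bij_betw_def by simp
  with one[OF assms] show ?thesis unfolding is_identity_def by metis
qed

text \<open>Multiplication by the unit of \<open>D g\<close> sees only the component at the target of \<open>g\<close>.\<close>

lemma partial_invariants_components:
  "x \<in> partial_invariants G R D \<alpha> \<longleftrightarrow> x \<in> R \<and> (\<forall>g\<in>elems G.
     \<alpha> g (R.comp x (src G g) * one (ginv G g)) = R.comp x (tgt G g) * one g)"
proof -
  have 1: "x * one g = R.comp x (tgt G g) * one g" if "g \<in> elems G" "x \<in> R" for g
    using that R.mult_summand tgt_identity ideal_subset[OF ideal_D one_mem] by blast
  have 2: "x * one (ginv G g) = R.comp x (src G g) * one (ginv G g)" if "g \<in> elems G" "x \<in> R" for g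
    using 1[OF inv_mem] that tgt_inv by simp
  from 1 2 show ?thesis unfolding partial_invariants_def by auto
qed

lemma subring_partial_invariants: "is_subring (partial_invariants G R D \<alpha>)"
  unfolding is_subring_def
proof (intro conjI ballI)
  show "0 \<in> partial_invariants G R D \<alpha>"
    using hom_zero[OF hom_\<alpha>] subring_zero[OF R.subring] unfolding partial_invariants_def by simp
next
  fix x y assume "x \<in> partial_invariants G R D \<alpha>" "y \<in> partial_invariants G R D \<alpha>"
  then have x: "x \<in> R" and y: "y \<in> R"
    and ix: "\<And>g. g \<in> elems G \<Longrightarrow>
      \<alpha> g (R.comp x (src G g) * one (ginv G g)) = R.comp x (tgt G g) * one g"
    and iy: "\<And>g. g \<in> elems G \<Longrightarrow>
      \<alpha> g (R.comp y (src G g) * one (ginv G g)) = R.comp y (tgt G g) * one g"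
    unfolding partial_invariants_components by blast+
  have mem: "R.comp z (src G g) * one (ginv G g) \<in> D (ginv G g)" if "z \<in> R" "g \<in> elems G" for z g
    using ideal_mult_left[OF ideal_D_inv one_mem[OF inv_mem] R.comp_mem[OF _ src_identity]] that
    by blast
  have prod: "a * b * one g = (a * one g) * (b * one g)"
    if g: "g \<in> elems G" and b: "b \<in> D (tgt G g)" for a b g
  proof -
    have "(a * one g) * (b * one g) = a * (one g * b) * one g" by (simp add: mult.assoc)
    also have "one g * b = b * one g"
      using ideal_identity_central[OF ideal_D[OF g] one[OF g] b] by simp
    also have "a * (b * one g) * one g = a * b * (one g * one g)" by (simp add: mult.assoc)
    also have "one g * one g = one g"
      using one[OF g] unfolding is_identity_def by blast
    finally show ?thesis by simp
  qed
  show "x - y \<in> partial_invariants G R D \<alpha>"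
    unfolding partial_invariants_components
    using x y ix iy mem hom_diff[OF hom_\<alpha>] subring_diff[OF R.subring] src_identity tgt_identity
    by (simp add: R.comp_diff left_diff_distrib)
  show "x * y \<in> partial_invariants G R D \<alpha>"
    unfolding partial_invariants_components
  proof (intro conjI ballI)
    show "x * y \<in> R" using x y subring_mult[OF R.subring] by blast
    fix g assume g: "g \<in> elems G"
    have "R.comp (x * y) (src G g) * one (ginv G g)
        = (R.comp x (src G g) * one (ginv G g)) * (R.comp y (src G g) * one (ginv G g))"
      using prod[OF inv_mem[OF g]] tgt_inv[OF g] R.comp_mem[OF y] R.comp_mult[OF x y]
        src_identity[OF g] by simp
    then have "\<alpha> g (R.comp (x * y) (src G g) * one (ginv G g))
        = (R.comp x (tgt G g) * one g) * (R.comp y (tgt G g) * one g)"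
      using hom_mult[OF hom_\<alpha>[OF g]] mem x y ix iy g by simp
    also have "\<dots> = R.comp (x * y) (tgt G g) * one g"
      using prod[OF g] R.comp_mem[OF y] R.comp_mult[OF x y] tgt_identity[OF g] by simp
    finally show "\<alpha> g (R.comp (x * y) (src G g) * one (ginv G g))
      = R.comp (x * y) (tgt G g) * one g" .
  qed
qed

subsection \<open>The global action\<close>

lemma partial_\<beta>: "partial_action G T E \<beta>"
  using globalization unfolding globalization_def global_action_def by blast

lemma E_eq_sum:
  "g \<in> elems G \<Longrightarrow> E g = family_sum {h \<in> elems G. tgt G h = tgt G g}
                    (\<lambda>h. \<beta> h ` \<psi> (src G h) ` D (src G h))"
  using globalization unfolding globalization_def by blast

lemma E_tgt:
  assumes "g \<in> elems G"
  shows "E g = E (tgt G g)"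
  unfolding E_eq_sum[OF assms] E_eq_sum[OF identity_mem[OF tgt_identity[OF assms]]]
    tgt_of_identity[OF tgt_identity[OF assms]] ..

lemma E_inv: "g \<in> elems G \<Longrightarrow> E (ginv G g) = E (src G g)"
  using E_tgt[OF inv_mem] tgt_inv by simp

lemma hom_\<beta>:
  assumes "g \<in> elems G"
  shows "rng_hom_on (E (src G g)) (E (tgt G g)) (\<beta> g)"
proof -
  have "rng_hom_on (E (ginv G g)) (E g) (\<beta> g)"
    using partial_\<beta> assms unfolding partial_action_def rng_iso_on_def by blast
  then show ?thesis unfolding E_inv[OF assms] E_tgt[OF assms] .
qed

lemma \<beta>_identity: "e \<in> identities G \<Longrightarrow> x \<in> E e \<Longrightarrow> \<beta> e x = x"
  using partial_\<beta> unfolding partial_action_def by blast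

lemma \<beta>_mult:
  assumes "g \<in> elems G" "h \<in> elems G" "src G g = tgt G h" "x \<in> E (src G h)"
  shows "\<beta> g (\<beta> h x) = \<beta> (gmult G g h) x"
proof -
  have "E (ginv G (gmult G g h)) = E (src G h)"
    using E_inv[OF mult_mem[OF assms(1-3)]] src_mult[OF assms(1-3)] by simp
  moreover have "global_action G T E \<beta>" using globalization unfolding globalization_def by blast
  ultimately show ?thesis
    using composableI[OF assms(1-3)] assms(4) unfolding global_action_def by fastforce
qed

lemma \<beta>_inv_left: "g \<in> elems G \<Longrightarrow> x \<in> E (src G g) \<Longrightarrow> \<beta> (ginv G g) (\<beta> g x) = x"
  using \<beta>_mult[of "ginv G g" g x] \<beta>_identity[of "src G g" x] inv_mem src_inv src_identity
  by (simp flip: src_def)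

lemma \<beta>_inv_right: "g \<in> elems G \<Longrightarrow> x \<in> E (tgt G g) \<Longrightarrow> \<beta> g (\<beta> (ginv G g) x) = x"
  using \<beta>_inv_left[of "ginv G g" x] inv_mem inv_inv[of g] src_inv[of g] by simp

lemma \<beta>_inv_mem: "g \<in> elems G \<Longrightarrow> x \<in> E (tgt G g) \<Longrightarrow> \<beta> (ginv G g) x \<in> E (src G g)"
  using hom_mem[OF hom_\<beta>[of "ginv G g"], of x] inv_mem src_inv[of g] tgt_inv[of g] by simp

lemma subring_global_invariants: "is_subring (global_invariants G T E \<beta>)"
  unfolding is_subring_def
proof (intro conjI ballI)
  show "0 \<in> global_invariants G T E \<beta>"
    unfolding global_invariants_def
    using subring_zero[OF T.subring] hom_zero[OF hom_\<beta>] src_identity tgt_identity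
    by (simp add: T.comp_zero)
next
  fix x y assume "x \<in> global_invariants G T E \<beta>" "y \<in> global_invariants G T E \<beta>"
  then have x: "x \<in> T" and y: "y \<in> T"
    and ix: "\<And>g. g \<in> elems G \<Longrightarrow> \<beta> g (T.comp x (src G g)) = T.comp x (tgt G g)"
    and iy: "\<And>g. g \<in> elems G \<Longrightarrow> \<beta> g (T.comp y (src G g)) = T.comp y (tgt G g)"
    unfolding global_invariants_def by blast+
  have "\<beta> g (T.comp (x - y) (src G g)) = T.comp (x - y) (tgt G g)
      \<and> \<beta> g (T.comp (x * y) (src G g)) = T.comp (x * y) (tgt G g)" if g: "g \<in> elems G" for g
  proof -
    note d = src_identity[OF g] and r = tgt_identity[OF g]
    note hom = hom_\<beta>[OF g] and mem = T.comp_mem[OF x d] T.comp_mem[OF y d]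
    show ?thesis
      unfolding T.comp_diff[OF x y d] T.comp_diff[OF x y r] T.comp_mult[OF x y d]
        T.comp_mult[OF x y r] hom_diff[OF hom mem] hom_mult[OF hom mem] ix[OF g] iy[OF g]
      by blast
  qed
  then show "x - y \<in> global_invariants G T E \<beta>" "x * y \<in> global_invariants G T E \<beta>"
    unfolding global_invariants_def
    using subring_diff[OF T.subring x y] subring_mult[OF T.subring x y] by blast+
qed

subsection \<open>The idempotents that cover the global rings\<close>

lemma hom_\<psi>: "e \<in> identities G \<Longrightarrow> rng_hom_on (D e) (E e) (\<psi> e)"
  using globalization unfolding globalization_def rng_mono_on_def by blast

lemma inj_\<psi>: "e \<in> identities G \<Longrightarrow> inj_on (\<psi> e) (D e)"
  using globalization unfolding globalization_def rng_mono_on_def by blast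

lemma ideal_\<psi>D: "e \<in> identities G \<Longrightarrow> is_ideal (\<psi> e ` D e) (E e)"
  using globalization unfolding globalization_def by blast

lemma \<psi>D_eq:
  "g \<in> elems G \<Longrightarrow> \<psi> (tgt G g) ` D g
     = \<psi> (tgt G g) ` D (tgt G g) \<inter> \<beta> g ` \<psi> (src G g) ` D (src G g)"
  using globalization unfolding globalization_def by blast

lemma \<beta>_\<psi>:
  "g \<in> elems G \<Longrightarrow> a \<in> D (ginv G g) \<Longrightarrow> \<beta> g (\<psi> (src G g) a) = \<psi> (tgt G g) (\<alpha> g a)"
  using globalization unfolding globalization_def by blast

lemma p: "e \<in> identities G \<Longrightarrow> is_identity (\<psi> e ` D e) (p e)"
  unfolding p_def using identity_image[OF hom_\<psi> one[OF identity_mem]] by blast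

lemma p_image: "e \<in> identities G \<Longrightarrow> p e \<in> \<psi> e ` D e"
  using p unfolding is_identity_def by blast

lemma p_mem: "e \<in> identities G \<Longrightarrow> p e \<in> E e"
  using p_image ideal_\<psi>D ideal_subset by blast

lemma p_idem: "e \<in> identities G \<Longrightarrow> p e * p e = p e"
  using p unfolding is_identity_def by blast

lemma p_central: "e \<in> identities G \<Longrightarrow> x \<in> E e \<Longrightarrow> x * p e = p e * x"
  using ideal_identity_central[OF ideal_\<psi>D p] by blast

lemma mult_p_image: "e \<in> identities G \<Longrightarrow> x \<in> E e \<Longrightarrow> x * p e \<in> \<psi> e ` D e"
  using ideal_mult_left[OF ideal_\<psi>D p_image] by blast

lemma \<psi>_mult_p: "e \<in> identities G \<Longrightarrow> x \<in> D e \<Longrightarrow> \<psi> e x * p e = \<psi> e x"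
  using p unfolding is_identity_def by blast

lemma u_mem: "g \<in> elems G \<Longrightarrow> u g \<in> E (tgt G g)"
  unfolding u_def using hom_mem[OF hom_\<beta> p_mem[OF src_identity]] .

lemma u_idem: "g \<in> elems G \<Longrightarrow> u g * u g = u g"
  unfolding u_def
  using hom_mult[OF hom_\<beta> p_mem[OF src_identity] p_mem[OF src_identity]] p_idem[OF src_identity]
  by metis

lemma u_identity: "e \<in> identities G \<Longrightarrow> u e = p e"
  unfolding u_def using src_of_identity \<beta>_identity p_mem by simp

lemma \<beta>_mult_u:
  assumes "g \<in> elems G" "x \<in> E (src G g)"
  shows "\<beta> g x * u g = \<beta> g (x * p (src G g))"
  unfolding u_def using hom_mult[OF hom_\<beta>[OF assms(1)] assms(2) p_mem[OF src_identity[OF assms(1)]]]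
  by simp

lemma u_central:
  assumes g: "g \<in> elems G" and x: "x \<in> E (tgt G g)"
  shows "x * u g = u g * x"
proof -
  let ?y = "\<beta> (ginv G g) x"
  have y: "?y \<in> E (src G g)" using \<beta>_inv_mem[OF g x] .
  have "x * u g = \<beta> g (?y * p (src G g))"
    using \<beta>_mult_u[OF g y] \<beta>_inv_right[OF g x] by simp
  also have "\<dots> = \<beta> g (p (src G g) * ?y)"
    using p_central[OF src_identity[OF g] y] by simp
  also have "\<dots> = u g * x"
    unfolding u_def using hom_mult[OF hom_\<beta>[OF g] p_mem[OF src_identity[OF g]] y] \<beta>_inv_right[OF g x]
    by simp
  finally show ?thesis .
qed

lemma \<beta>_u:
  assumes "g \<in> elems G" "h \<in> elems G" "src G g = tgt G h"
  shows "\<beta> g (u h) = u (gmult G g h)"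
  unfolding u_def
  using \<beta>_mult[OF assms p_mem[OF src_identity[OF assms(2)]]] src_mult[OF assms] by simp

lemma eq_if_eq_on_cover:
  assumes e: "e \<in> identities G" and "x \<in> E e" "y \<in> E e"
    and "\<And>h. h \<in> elems G \<Longrightarrow> tgt G h = e \<Longrightarrow> x * u h = y * u h"
  shows "x = y"
proof (rule eq_if_eq_on_idempotents[where u = u and I = "{h \<in> elems G. tgt G h = e}" and S = "E e"])
  fix s assume "s \<in> E e"
  then obtain f where f: "f \<in> Pi\<^sub>E {h \<in> elems G. tgt G h = e} (\<lambda>h. \<beta> h ` \<psi> (src G h) ` D (src G h))"
    "s = (\<Sum>h | h \<in> elems G \<and> tgt G h = e. f h)"
    using E_eq_sum[OF identity_mem[OF e]] tgt_of_identity[OF e] unfolding family_sum_def by auto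
  have "f h \<in> E e \<and> f h * u h = f h" if h: "h \<in> elems G" "tgt G h = e" for h
  proof -
    have "f h \<in> \<beta> h ` \<psi> (src G h) ` D (src G h)" using f(1) h by (auto simp: PiE_iff)
    then obtain a where a: "a \<in> D (src G h)" "f h = \<beta> h (\<psi> (src G h) a)" by blast
    have "\<psi> (src G h) a \<in> E (src G h)" using hom_mem[OF hom_\<psi>[OF src_identity[OF h(1)]] a(1)] .
    then show ?thesis
      using hom_mem[OF hom_\<beta>[OF h(1)]] \<beta>_mult_u[OF h(1)] \<psi>_mult_p[OF src_identity[OF h(1)] a(1)] a(2) h(2)
      by simp
  qed
  then show "\<exists>f. (\<forall>i\<in>{h \<in> elems G. tgt G h = e}. f i \<in> E e \<and> f i * u i = f i)
      \<and> s = (\<Sum>i\<in>{h \<in> elems G. tgt G h = e}. f i)"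
    using f(2) by blast
next
  show "s * u i = u i * s" if "i \<in> {h \<in> elems G. tgt G h = e}" "s \<in> E e" for i s
    using u_central that by blast
qed (use assms finite_elems T.subring_summand u_mem u_idem in auto)

text \<open>The image of \<open>D g\<close> is the intersection of the ideals with units \<open>u g\<close> and \<open>p (tgt g)\<close>, and the
  unit of an intersection of two such ideals is the product of their units.\<close>

lemma translated_unit_times_unit:
  assumes g: "g \<in> elems G"
  shows "u g * p (tgt G g) = \<psi> (tgt G g) (one g)"
proof -
  let ?r = "tgt G g" and ?d = "src G g"
  let ?q = "\<psi> ?r (one g)" and ?v = "u g * p ?r"
  have r: "?r \<in> identities G" and d: "?d \<in> identities G"
    using g src_identity tgt_identity by blast+
  have "D g \<subseteq> D ?r" using ideal_subset[OF ideal_D[OF g]] by blast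
  then have "rng_hom_on (D g) (E ?r) (\<psi> ?r)"
    using hom_\<psi>[OF r] ideal_imp_subring[OF ideal_D[OF g]] unfolding rng_hom_on_def by blast
  then have q: "is_identity (\<psi> ?r ` D g) ?q" using identity_image one[OF g] by blast
  have "?v = \<beta> g (\<beta> (ginv G g) (p ?r) * p ?d)"
    using \<beta>_mult_u[OF g \<beta>_inv_mem[OF g p_mem[OF r]]] \<beta>_inv_right[OF g p_mem[OF r]]
      u_central[OF g p_mem[OF r]] by simp
  then have "?v \<in> \<beta> g ` \<psi> ?d ` D ?d"
    using mult_p_image[OF d \<beta>_inv_mem[OF g p_mem[OF r]]] by simp
  then have "?v \<in> \<psi> ?r ` D g"
    using \<psi>D_eq[OF g] mult_p_image[OF r u_mem[OF g]] by simp
  then have "?v * ?q = ?v" using q unfolding is_identity_def by blast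
  moreover have "?v * ?q = ?q"
  proof -
    have "?q \<in> \<psi> ?r ` D g" using q unfolding is_identity_def by blast
    then have q1: "?q \<in> \<psi> ?r ` D ?r" and "?q \<in> \<beta> g ` \<psi> ?d ` D ?d" using \<psi>D_eq[OF g] by blast+
    then obtain a where a: "a \<in> D ?d" "?q = \<beta> g (\<psi> ?d a)" by blast
    have "p ?r * ?q = ?q" using q1 p[OF r] unfolding is_identity_def by blast
    moreover have "?q * u g = ?q"
      using a \<beta>_mult_u[OF g hom_mem[OF hom_\<psi>[OF d] a(1)]] \<psi>_mult_p[OF d a(1)] by simp
    moreover have "?q * u g = u g * ?q"
      using u_central[OF g ideal_subset[OF ideal_\<psi>D[OF r] q1]] .
    ultimately show ?thesis by (simp add: mult.assoc)
  qed
  ultimately show ?thesis by simp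
qed

subsection \<open>Truncation of global invariants\<close>

definition truncate :: "'t \<Rightarrow> 'r" where
  "truncate a = (\<Sum>e\<in>identities G. inv_into (D e) (\<psi> e) (T.comp a e * p e))"

lemma truncate_components:
  assumes a: "a \<in> T"
  shows truncate_mem: "truncate a \<in> R"
    and \<psi>_comp_truncate: "\<And>e. e \<in> identities G \<Longrightarrow> \<psi> e (R.comp (truncate a) e) = T.comp a e * p e"
proof -
  have m: "T.comp a e * p e \<in> \<psi> e ` D e" if "e \<in> identities G" for e
    using mult_p_image[OF that T.comp_mem[OF a that]] .
  then have i: "inv_into (D e) (\<psi> e) (T.comp a e * p e) \<in> D e" if "e \<in> identities G" for e
    using that inv_into_into by metis
  show "truncate a \<in> R" unfolding truncate_def using i by (rule R.sum_mem)
  show "\<psi> e (R.comp (truncate a) e) = T.comp a e * p e" if "e \<in> identities G" for e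
    unfolding truncate_def using R.comp_sum[OF i that] f_inv_into_f[OF m[OF that]] by simp
qed

lemma R_eqI:
  assumes "x \<in> R" "y \<in> R"
    and "\<And>e. e \<in> identities G \<Longrightarrow> \<psi> e (R.comp x e) = \<psi> e (R.comp y e)"
  shows "x = y"
  using assms(1,2)
  by (rule R.comp_eqI) (use assms R.comp_mem inj_onD[OF inj_\<psi>] in blast)

lemma truncate_add:
  assumes a: "a \<in> T" and b: "b \<in> T"
  shows "truncate (a + b) = truncate a + truncate b"
proof (rule R_eqI)
  have ab: "a + b \<in> T" using subring_add[OF T.subring a b] .
  note ta = truncate_mem[OF a] and tb = truncate_mem[OF b]
  show "truncate (a + b) \<in> R" using truncate_mem[OF ab] .
  show "truncate a + truncate b \<in> R" using subring_add[OF R.subring ta tb] .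
  fix e assume e: "e \<in> identities G"
  show "\<psi> e (R.comp (truncate (a + b)) e) = \<psi> e (R.comp (truncate a + truncate b) e)"
    unfolding R.comp_add[OF ta tb e] hom_add[OF hom_\<psi>[OF e] R.comp_mem[OF ta e] R.comp_mem[OF tb e]]
      \<psi>_comp_truncate[OF a e] \<psi>_comp_truncate[OF b e] \<psi>_comp_truncate[OF ab e] T.comp_add[OF a b e]
    by (rule distrib_right)
qed

lemma truncate_mult:
  assumes a: "a \<in> T" and b: "b \<in> T"
  shows "truncate (a * b) = truncate a * truncate b"
proof (rule R_eqI)
  have ab: "a * b \<in> T" using subring_mult[OF T.subring a b] .
  note ta = truncate_mem[OF a] and tb = truncate_mem[OF b]
  show "truncate (a * b) \<in> R" using truncate_mem[OF ab] .
  show "truncate a * truncate b \<in> R" using subring_mult[OF R.subring ta tb] .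
  fix e assume e: "e \<in> identities G"
  have "\<psi> e (R.comp (truncate (a * b)) e) = T.comp a e * (T.comp b e * (p e * p e))"
    using \<psi>_comp_truncate[OF ab e] T.comp_mult[OF a b e] p_idem[OF e] by (simp add: mult.assoc)
  also have "\<dots> = T.comp a e * (T.comp b e * p e) * p e" by (simp add: mult.assoc)
  also have "\<dots> = (T.comp a e * p e) * (T.comp b e * p e)"
    using p_central[OF e T.comp_mem[OF b e]] by (simp add: mult.assoc)
  also have "\<dots> = \<psi> e (R.comp (truncate a * truncate b) e)"
    unfolding R.comp_mult[OF ta tb e] hom_mult[OF hom_\<psi>[OF e] R.comp_mem[OF ta e] R.comp_mem[OF tb e]]
      \<psi>_comp_truncate[OF a e] \<psi>_comp_truncate[OF b e] ..
  finally show "\<psi> e (R.comp (truncate (a * b)) e) = \<psi> e (R.comp (truncate a * truncate b) e)" .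
qed

lemma \<psi>_mult_one:
  assumes g: "g \<in> elems G" and x: "x \<in> D (tgt G g)"
  shows "\<psi> (tgt G g) (x * one g) = \<psi> (tgt G g) x * \<psi> (tgt G g) (one g)"
    "p (tgt G g) * \<psi> (tgt G g) (one g) = \<psi> (tgt G g) (one g)"
proof -
  have m: "one g \<in> D (tgt G g)" using ideal_subset[OF ideal_D one_mem] g by blast
  show "\<psi> (tgt G g) (x * one g) = \<psi> (tgt G g) x * \<psi> (tgt G g) (one g)"
    using hom_mult[OF hom_\<psi>[OF tgt_identity[OF g]] x m] .
  show "p (tgt G g) * \<psi> (tgt G g) (one g) = \<psi> (tgt G g) (one g)"
    using p[OF tgt_identity[OF g]] m unfolding is_identity_def by blast
qed

text \<open>Invariance of \<open>x\<close> under \<open>g\<close>, transported to \<open>E (tgt g)\<close>: it compares the translate of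
  the component of \<open>x\<close> at the source with the component at the target after multiplication by the
  unit of the image of \<open>D g\<close>.\<close>

lemma \<psi>_invariance:
  assumes g: "g \<in> elems G" and x: "x \<in> D (src G g)" and y: "y \<in> D (tgt G g)"
  shows "\<alpha> g (x * one (ginv G g)) = y * one g \<longleftrightarrow>
    \<beta> g (\<psi> (src G g) x) * \<psi> (tgt G g) (one g) = \<psi> (tgt G g) y * \<psi> (tgt G g) (one g)"
proof -
  let ?d = "src G g" and ?r = "tgt G g"
  have g': "ginv G g \<in> elems G" "tgt G (ginv G g) = ?d" using inv_mem[OF g] tgt_inv[OF g] by auto
  have d: "?d \<in> identities G" and r: "?r \<in> identities G" using g src_identity tgt_identity by blast+
  have o: "one (ginv G g) \<in> D ?d" using ideal_subset[OF ideal_D_inv[OF g] one_mem[OF g'(1)]] .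
  have xo: "x * one (ginv G g) \<in> D (ginv G g)"
    using ideal_mult_left[OF ideal_D_inv[OF g] one_mem[OF g'(1)] x] .
  have "\<psi> ?r (\<alpha> g (x * one (ginv G g))) = \<beta> g (\<psi> ?d (x * one (ginv G g)))"
    using \<beta>_\<psi>[OF g xo] by simp
  also have "\<dots> = \<beta> g (\<psi> ?d x) * \<beta> g (\<psi> ?d (one (ginv G g)))"
    using hom_mult[OF hom_\<psi>[OF d] x o]
      hom_mult[OF hom_\<beta>[OF g] hom_mem[OF hom_\<psi>[OF d] x] hom_mem[OF hom_\<psi>[OF d] o]] by simp
  also have "\<dots> = \<beta> g (\<psi> ?d x) * \<psi> ?r (one g)"
    using \<beta>_\<psi>[OF g one_mem[OF g'(1)]] \<alpha>_one[OF g] by simp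
  finally have 1: "\<psi> ?r (\<alpha> g (x * one (ginv G g))) = \<beta> g (\<psi> ?d x) * \<psi> ?r (one g)" .
  have "\<alpha> g (x * one (ginv G g)) \<in> D ?r"
    using hom_mem[OF hom_\<alpha>[OF g] xo] ideal_subset[OF ideal_D[OF g]] by blast
  moreover have "y * one g \<in> D ?r"
    using ideal_mult_left[OF ideal_D[OF g] one_mem[OF g] y] ideal_subset[OF ideal_D[OF g]] by blast
  ultimately have "\<alpha> g (x * one (ginv G g)) = y * one g
      \<longleftrightarrow> \<psi> ?r (\<alpha> g (x * one (ginv G g))) = \<psi> ?r (y * one g)"
    using inj_\<psi>[OF r] by (auto dest: inj_onD)
  then show ?thesis unfolding 1 \<psi>_mult_one(1)[OF g y] .
qed

lemma truncate_invariant: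
  assumes "a \<in> global_invariants G T E \<beta>"
  shows "truncate a \<in> partial_invariants G R D \<alpha>"
proof -
  have a: "a \<in> T" and inv: "\<And>g. g \<in> elems G \<Longrightarrow> \<beta> g (T.comp a (src G g)) = T.comp a (tgt G g)"
    using assms unfolding global_invariants_def by auto
  show ?thesis
    unfolding partial_invariants_components
  proof (intro conjI ballI)
    show t: "truncate a \<in> R" using truncate_mem[OF a] .
    fix g assume g: "g \<in> elems G"
    let ?d = "src G g" and ?r = "tgt G g"
    have d: "?d \<in> identities G" and r: "?r \<in> identities G" using g src_identity tgt_identity by blast+
    note y = R.comp_mem[OF t r]
    have "\<beta> g (\<psi> ?d (R.comp (truncate a) ?d)) = T.comp a ?r * u g"
      using \<psi>_comp_truncate[OF a d] \<beta>_mult_u[OF g T.comp_mem[OF a d]] inv[OF g] by simp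
    moreover have "u g * \<psi> ?r (one g) = \<psi> ?r (one g)"
      using translated_unit_times_unit[OF g] u_idem[OF g] by (metis mult.assoc)
    moreover have "\<psi> ?r (R.comp (truncate a) ?r) * \<psi> ?r (one g) = T.comp a ?r * \<psi> ?r (one g)"
      using \<psi>_comp_truncate[OF a r] \<psi>_mult_one(2)[OF g y] by (simp add: mult.assoc)
    ultimately show "\<alpha> g (R.comp (truncate a) ?d * one (ginv G g)) = R.comp (truncate a) ?r * one g"
      unfolding \<psi>_invariance[OF g R.comp_mem[OF t d] y] by (simp add: mult.assoc)
  qed
qed

lemma truncate_inj: "inj_on truncate (global_invariants G T E \<beta>)"
proof (rule inj_onI)
  fix a b assume ab: "a \<in> global_invariants G T E \<beta>" "b \<in> global_invariants G T E \<beta>"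
    and eq: "truncate a = truncate b"
  have a: "a \<in> T" and inva: "\<And>g. g \<in> elems G \<Longrightarrow> \<beta> g (T.comp a (src G g)) = T.comp a (tgt G g)"
    and b: "b \<in> T" and invb: "\<And>g. g \<in> elems G \<Longrightarrow> \<beta> g (T.comp b (src G g)) = T.comp b (tgt G g)"
    using ab unfolding global_invariants_def by auto
  show "a = b"
  proof (rule T.comp_eqI[OF a b])
    fix e assume e: "e \<in> identities G"
    show "T.comp a e = T.comp b e"
    proof (rule eq_if_eq_on_cover[OF e T.comp_mem[OF a e] T.comp_mem[OF b e]])
      fix h assume h: "h \<in> elems G" "tgt G h = e"
      have d: "src G h \<in> identities G" using src_identity[OF h(1)] .
      have "T.comp a (src G h) * p (src G h) = T.comp b (src G h) * p (src G h)"
        using \<psi>_comp_truncate[OF a d] \<psi>_comp_truncate[OF b d] eq by simp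
      then show "T.comp a e * u h = T.comp b e * u h"
        using \<beta>_mult_u[OF h(1) T.comp_mem[OF a d]] \<beta>_mult_u[OF h(1) T.comp_mem[OF b d]]
          inva[OF h(1)] invb[OF h(1)] h(2) by simp
    qed
  qed
qed

subsection \<open>Extension of partial invariants\<close>

text \<open>The agreement on overlaps. Translating by the inverse of \<open>k\<close> reduces the claim to the element \<open>g\<close>
  with \<open>k g = h\<close>, for which both sides become multiples of \<open>u g * p (tgt g)\<close>, the image of the
  unit of \<open>D g\<close>.\<close>

lemma local_data_agree:
  assumes x: "x \<in> partial_invariants G R D \<alpha>"
    and h: "h \<in> elems G" and k: "k \<in> elems G" and hk: "tgt G h = tgt G k"
  shows "\<beta> h (\<psi> (src G h) (R.comp x (src G h))) * u k = \<beta> k (\<psi> (src G k) (R.comp x (src G k))) * u h"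
proof -
  let ?d = "src G h" and ?r = "src G k"
  let ?xd = "\<psi> ?d (R.comp x ?d)" and ?xr = "\<psi> ?r (R.comp x ?r)"
  obtain g where g: "g \<in> elems G" "src G g = ?d" "tgt G g = ?r" and kg: "gmult G k g = h"
    using left_division[OF k h hk[symmetric]] by blast
  have d: "?d \<in> identities G" and r: "?r \<in> identities G" using h k src_identity by blast+
  have xR: "x \<in> R" using x unfolding partial_invariants_def by blast
  have xd: "?xd \<in> E ?d" and xr: "?xr \<in> E ?r"
    using hom_mem[OF hom_\<psi>] R.comp_mem[OF xR] d r by blast+
  have bxd: "\<beta> g ?xd \<in> E ?r" using hom_mem[OF hom_\<beta>[OF g(1)]] xd g by simp
  have ug: "u g \<in> E ?r" using u_mem[OF g(1)] g(3) by simp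
  have q: "u g * p ?r = \<psi> ?r (one g)" using translated_unit_times_unit[OF g(1)] g(3) by simp
  have "\<alpha> g (R.comp x ?d * one (ginv G g)) = R.comp x ?r * one g"
    using x g unfolding partial_invariants_components by metis
  then have inv: "\<beta> g ?xd * (u g * p ?r) = ?xr * (u g * p ?r)"
    using \<psi>_invariance[OF g(1)] R.comp_mem[OF xR] d r q unfolding g(2,3) by simp
  have "\<beta> g ?xd * p ?r = \<beta> g ?xd * (u g * p ?r)"
    using \<beta>_mult_u[OF g(1)] xd \<psi>_mult_p[OF d R.comp_mem[OF xR d]] unfolding g(2)
    by (simp flip: mult.assoc)
  also have "\<dots> = ?xr * (p ?r * u g)"
    using inv p_central[OF r ug] by simp
  also have "\<dots> = ?xr * u g"
    using \<psi>_mult_p[OF r R.comp_mem[OF xR r]] by (simp flip: mult.assoc)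
  finally have "\<beta> k (\<beta> g ?xd * p ?r) = \<beta> k (?xr * u g)" by simp
  moreover have "\<beta> k (\<beta> g ?xd * p ?r) = \<beta> h ?xd * u k"
    using \<beta>_mult_u[OF k bxd] \<beta>_mult[OF k g(1) g(3)[symmetric]] xd kg unfolding g(2) by simp
  moreover have "\<beta> k (?xr * u g) = \<beta> k ?xr * u h"
    using hom_mult[OF hom_\<beta>[OF k] xr ug] \<beta>_u[OF k g(1) g(3)[symmetric]] kg by simp
  ultimately show ?thesis by simp
qed

lemma truncate_surj:
  assumes x: "x \<in> partial_invariants G R D \<alpha>"
  shows "\<exists>a\<in>global_invariants G T E \<beta>. truncate a = x"
proof -
  have xR: "x \<in> R" using x unfolding partial_invariants_def by blast
  define y where "y h = \<beta> h (\<psi> (src G h) (R.comp x (src G h)))" for h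
  have \<psi>x: "\<psi> e (R.comp x e) \<in> E e" if "e \<in> identities G" for e
    using hom_mem[OF hom_\<psi>[OF that] R.comp_mem[OF xR that]] .
  have y_mem: "y h \<in> E (tgt G h)" if "h \<in> elems G" for h
    unfolding y_def using hom_mem[OF hom_\<beta>[OF that] \<psi>x[OF src_identity[OF that]]] .
  have y_u: "y h * u h = y h" if "h \<in> elems G" for h
    unfolding y_def using \<beta>_mult_u[OF that \<psi>x[OF src_identity[OF that]]]
      \<psi>_mult_p[OF src_identity[OF that] R.comp_mem[OF xR src_identity[OF that]]] by simp
  have y_id: "y e = \<psi> e (R.comp x e)" if "e \<in> identities G" for e
    unfolding y_def using src_of_identity[OF that] \<beta>_identity[OF that \<psi>x[OF that]] by simp
  have "\<exists>z\<in>E e. \<forall>h\<in>{h \<in> elems G. tgt G h = e}. z * u h = y h" if e: "e \<in> identities G" for e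
  proof (rule glue_along_idempotents)
    show "y i * u j = y j * u i"
      if "i \<in> {h \<in> elems G. tgt G h = e}" "j \<in> {h \<in> elems G. tgt G h = e}" for i j
      unfolding y_def using local_data_agree[OF x] that by simp
    show "s * u i = u i * s" if "i \<in> {h \<in> elems G. tgt G h = e}" "s \<in> E e" for i s
      using u_central that by blast
  qed (use e finite_elems T.subring_summand u_mem u_idem y_mem y_u in auto)
  then have "\<forall>e\<in>identities G. \<exists>z. z \<in> E e \<and> (\<forall>h\<in>elems G. tgt G h = e \<longrightarrow> z * u h = y h)"
    by blast
  from bchoice[OF this] obtain c where c: "\<And>e. e \<in> identities G \<Longrightarrow> c e \<in> E e"
    and cu: "\<And>h. h \<in> elems G \<Longrightarrow> c (tgt G h) * u h = y h"
    using tgt_identity by blast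
  define a where "a = (\<Sum>e\<in>identities G. c e)"
  have a: "a \<in> T" unfolding a_def using c by (rule T.sum_mem)
  have ca: "T.comp a e = c e" if "e \<in> identities G" for e
    unfolding a_def using T.comp_sum c that by blast
  have "\<beta> g (c (src G g)) = c (tgt G g)" if g: "g \<in> elems G" for g
  proof (rule eq_if_eq_on_cover[OF tgt_identity[OF g]])
    show "\<beta> g (c (src G g)) \<in> E (tgt G g)" using hom_mem[OF hom_\<beta>[OF g] c[OF src_identity[OF g]]] .
    show "c (tgt G g) \<in> E (tgt G g)" using c[OF tgt_identity[OF g]] .
    fix h assume h: "h \<in> elems G" "tgt G h = tgt G g"
    obtain k where k: "k \<in> elems G" "src G k = src G h" "tgt G k = src G g" and gk: "gmult G g k = h"
      using left_division[OF g h(1) h(2)[symmetric]] by blast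
    have uk: "u k \<in> E (src G g)" using u_mem[OF k(1)] k(3) by simp
    have "\<beta> g (c (src G g)) * u h = \<beta> g (c (src G g) * u k)"
      using hom_mult[OF hom_\<beta>[OF g] c[OF src_identity[OF g]] uk] \<beta>_u[OF g k(1) k(3)[symmetric]] gk
      by simp
    also have "\<dots> = \<beta> g (y k)" using cu[OF k(1)] k(3) by simp
    also have "\<dots> = y h"
      unfolding y_def using \<beta>_mult[OF g k(1) k(3)[symmetric]] \<psi>x[OF src_identity[OF h(1)]] gk k(2)
      by simp
    also have "\<dots> = c (tgt G g) * u h" using cu[OF h(1)] h(2) by simp
    finally show "\<beta> g (c (src G g)) * u h = c (tgt G g) * u h" .
  qed
  then have "a \<in> global_invariants G T E \<beta>"
    unfolding global_invariants_def using a ca src_identity tgt_identity by simp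
  moreover have "truncate a = x"
  proof (rule R_eqI[OF truncate_mem[OF a] xR])
    fix e assume e: "e \<in> identities G"
    \<comment> \<open>The cover of \<open>E e\<close> contains \<open>u e = p e\<close>, and its local datum is the component of \<open>x\<close> at \<open>e\<close>.\<close>
    show "\<psi> e (R.comp (truncate a) e) = \<psi> e (R.comp x e)"
      using \<psi>_comp_truncate[OF a e] ca[OF e] cu[OF identity_mem[OF e]] tgt_of_identity[OF e] u_identity[OF e] y_id[OF e]
      by simp
  qed
  ultimately show ?thesis by blast
qed

lemma truncate_iso:
  "rng_iso_on (global_invariants G T E \<beta>) (partial_invariants G R D \<alpha>) truncate"
proof -
  have "global_invariants G T E \<beta> \<subseteq> T" unfolding global_invariants_def by blast
  then have "rng_hom_on (global_invariants G T E \<beta>) (partial_invariants G R D \<alpha>) truncate"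
    unfolding rng_hom_on_def
    using subring_global_invariants subring_partial_invariants truncate_invariant
      truncate_add truncate_mult by blast
  moreover have "truncate ` global_invariants G T E \<beta> = partial_invariants G R D \<alpha>"
    using truncate_invariant truncate_surj by blast
  ultimately show ?thesis
    unfolding rng_iso_on_def bij_betw_def using truncate_inj by blast
qed

end

section \<open>The isomorphism of invariants\<close>

theorem theorem4p6:
  fixes G :: "'g groupoid"
    and R :: "'r::ring set" and D :: "'g \<Rightarrow> 'r set" and \<alpha> :: "'g \<Rightarrow> 'r \<Rightarrow> 'r"
    and T :: "'t::ring set" and E :: "'g \<Rightarrow> 't set" and \<beta> :: "'g \<Rightarrow> 't \<Rightarrow> 't"
    and \<psi> :: "'g \<Rightarrow> 'r \<Rightarrow> 't"
  assumes "is_groupoid G" and "finite (elems G)"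
    and "partial_action G R D \<alpha>"
    and "\<forall>g\<in>elems G. unital (D g)"
    and "globalization G D \<alpha> T E \<beta> \<psi>"
    and "internal_direct_sum T (identities G) E"
    and "internal_direct_sum R (identities G) D"
    and "\<forall>e\<in>identities G. is_ideal (\<psi> e ` D e) (E e)"
  shows "rng_isomorphic (partial_invariants G R D \<alpha>) (global_invariants G T E \<beta>)"
proof -
  interpret globalized_action G R D \<alpha> T E \<beta> \<psi>
    using assms by unfold_locales
  show ?thesis
    unfolding rng_isomorphic_def using rng_iso_on_inv_into[OF truncate_iso] by blast
qed

end
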